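(* For $p^*\in[0,1]$ satisfying $Q(p^* )=\sum_{i=1}^n\mathbb{E}\left[(v_i-Q(p^* ))^+\right]$ it holds that $\mathbb{T}(p^* )\ge\frac12$.
   Context: There are $n\ge 1$ boxes with independent nonnegative rewards $v_1,\dots,v_n$ whose distributions have no point masses. $Z=\max_{i\in[n]}v_i$ (the prophet), normalized so that $\mathbb{E}[Z]=1$. The quantile function of $Z$ is $Q(p)=\sup\{x\mid \Pr[Z\le x]=p\}$ for $p\in[0,1]$ (values in $\mathbb{R}_{\ge0}\cup\{\infty\}$). Define $\mathbb{T}:[0,1]\to\mathbb{R}_{\ge0}$ by $\mathbb{T}(p)=p\int_p^1 \frac{Q(q)}{q^2}\,dq$ for $p\in(0,1]$, with $\mathbb{T}(0)=\lim_{p\to0^+}\mathbb{T}(p)$. Here $x^+=\max\{x,0\}$. *)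

theory Defs
  imports "HOL-Probability.Probability"
begin

definition prophet :: "nat \<Rightarrow> (nat \<Rightarrow> 'a \<Rightarrow> real) \<Rightarrow> 'a \<Rightarrow> real" where
  "prophet n v \<omega> = Max ((\<lambda>i. v i \<omega>) ` {1..n})"

text \<open>The supremum ranges over the extended half-line, so that \<open>quantile M Z 1 = \<infinity>\<close>,
  also when \<open>Z\<close> is unbounded and no real \<open>x\<close> attains probability 1.\<close>

definition quantile :: "'a measure \<Rightarrow> ('a \<Rightarrow> real) \<Rightarrow> real \<Rightarrow> ennreal" where
  "quantile M Z p = Sup {x. measure M {\<omega> \<in> space M. ennreal (Z \<omega>) \<le> x} = p}"

definition tail_transform_pos :: "'a measure \<Rightarrow> ('a \<Rightarrow> real) \<Rightarrow> real \<Rightarrow> real" where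
  "tail_transform_pos M Z p =
     p * enn2real (\<integral>\<^sup>+q\<in>{p..1}. (quantile M Z q / ennreal (q\<^sup>2)) \<partial>lborel)"

definition tail_transform :: "'a measure \<Rightarrow> ('a \<Rightarrow> real) \<Rightarrow> real \<Rightarrow> real" where
  "tail_transform M Z p =
     (if p = 0 then Lim (at_right 0) (tail_transform_pos M Z) else tail_transform_pos M Z p)"

text \<open>Subtraction on \<^typ>\<open>ennreal\<close> is the positive part of the difference of extended reals,
  and a finite number minus \<open>\<infinity>\<close> is 0.\<close>

definition expected_excess :: "'a measure \<Rightarrow> ('a \<Rightarrow> real) \<Rightarrow> ennreal \<Rightarrow> ennreal" where
  "expected_excess M X t = (\<integral>\<^sup>+\<omega>. (ennreal (X \<omega>) - t) \<partial>M)"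

end

theory Submission
  imports Defs
begin

text \<open>Write \<open>F\<close> for the distribution function of \<open>Z\<close>. Since \<open>Q q\<close> is the length of
  \<open>{x \<ge> 0. F x \<le> q}\<close>, Fubini gives
  \<open>T p = \<integral>\<^sub>0\<^sup>\<infinity> (p / max p (F x) - p) dx\<close>, with \<open>T 0 = Q 0\<close> by dominated convergence.
  Let \<open>t = Q p\<close>. Below \<open>t\<close> the integrand is \<open>1 - p\<close>; above \<open>t\<close> it is \<open>p (1 / F x - 1)\<close>,
  and independence with \<open>\<Prod>(1 + a\<^sub>i) \<ge> 1 + \<Sum>a\<^sub>i\<close> bounds this below by
  \<open>p \<Sum>(1 - F\<^sub>i x)\<close>. Hence \<open>T p \<ge> (1 - p) t + p \<Sum>E(v\<^sub>i - t)\<^sup>+ = t\<close>, while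
  \<open>1 = E Z \<le> t + \<Sum>E(v\<^sub>i - t)\<^sup>+ = 2 t\<close>.\<close>

section \<open>Excesses as tail integrals\<close>

text \<open>Layer-cake formula: the positive part of \<open>X \<omega> - t\<close> is the length of
  \<open>{t..<X \<omega>}\<close>, and Fubini turns the mean length into an integral of tail
  probabilities. The interval is half-open so that \<open>x < X \<omega>\<close> is exactly the
  complement of the event in the distribution function.\<close>

lemma (in prob_space) expected_excess_eq_nn_integral_tail:
  fixes X :: "'a \<Rightarrow> real"
  assumes [measurable]: "X \<in> borel_measurable M" and t: "t \<ge> 0"
  shows "expected_excess M X (ennreal t) =
    (\<integral>\<^sup>+x\<in>{t..}. ennreal (1 - prob {\<omega>\<in>space M. X \<omega> \<le> x}) \<partial>lborel)"
proof -
  interpret pair_sigma_finite M lborel ..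
  have "expected_excess M X (ennreal t) =
      (\<integral>\<^sup>+\<omega>. (\<integral>\<^sup>+x. indicator {(\<omega>, x). t \<le> x \<and> x < X \<omega>} (\<omega>, x) \<partial>lborel) \<partial>M)"
    unfolding expected_excess_def
  proof (rule nn_integral_cong)
    fix \<omega>
    have "(\<integral>\<^sup>+x. indicator {(\<omega>, x). t \<le> x \<and> x < X \<omega>} (\<omega>, x) \<partial>lborel) =
        (\<integral>\<^sup>+x. indicator {t..<X \<omega>} x \<partial>lborel)"
      by (intro nn_integral_cong) (auto split: split_indicator)
    also have "\<dots> = emeasure lborel {t..<X \<omega>}" by simp
    also have "\<dots> = ennreal (X \<omega>) - ennreal t"
      by (cases "t \<le> X \<omega>") (auto simp: ennreal_minus[OF t] ennreal_neg)
    finally show "ennreal (X \<omega>) - ennreal t =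
        (\<integral>\<^sup>+x. indicator {(\<omega>, x). t \<le> x \<and> x < X \<omega>} (\<omega>, x) \<partial>lborel)" by simp
  qed
  also have "\<dots> = (\<integral>\<^sup>+x. (\<integral>\<^sup>+\<omega>. indicator {(\<omega>, x). t \<le> x \<and> x < X \<omega>} (\<omega>, x) \<partial>M) \<partial>lborel)"
    by (rule Fubini'[symmetric]) measurable
  also have "\<dots> = (\<integral>\<^sup>+x\<in>{t..}. ennreal (1 - prob {\<omega>\<in>space M. X \<omega> \<le> x}) \<partial>lborel)"
  proof (rule nn_integral_cong)
    fix x
    have "(\<integral>\<^sup>+\<omega>. indicator {(\<omega>, x). t \<le> x \<and> x < X \<omega>} (\<omega>, x) \<partial>M) =
        (\<integral>\<^sup>+\<omega>. indicator {t..} x * indicator (space M - {\<omega>\<in>space M. X \<omega> \<le> x}) \<omega> \<partial>M)"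
      by (intro nn_integral_cong) (auto split: split_indicator)
    also have "\<dots> = indicator {t..} x * emeasure M (space M - {\<omega>\<in>space M. X \<omega> \<le> x})"
      by (subst nn_integral_cmult_indicator) auto
    also have "\<dots> = ennreal (1 - prob {\<omega>\<in>space M. X \<omega> \<le> x}) * indicator {t..} x"
      by (simp add: emeasure_eq_measure prob_compl mult.commute)
    finally show "(\<integral>\<^sup>+\<omega>. indicator {(\<omega>, x). t \<le> x \<and> x < X \<omega>} (\<omega>, x) \<partial>M) =
        ennreal (1 - prob {\<omega>\<in>space M. X \<omega> \<le> x}) * indicator {t..} x" .
  qed
  finally show ?thesis .
qed

section \<open>A product inequality\<close>

lemma one_plus_sum_le_prod:
  fixes f :: "'b \<Rightarrow> real"
  assumes "finite A" "\<And>i. i \<in> A \<Longrightarrow> 0 \<le> f i"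
  shows "1 + sum f A \<le> (\<Prod>i\<in>A. 1 + f i)"
  using assms
proof (induction A rule: finite_induct)
  case (insert a A)
  have "1 + sum f (insert a A) \<le> (1 + f a) * (1 + sum f A)"
    using insert by (simp add: algebra_simps sum_nonneg)
  also have "\<dots> \<le> (1 + f a) * (\<Prod>i\<in>A. 1 + f i)"
    using insert by (intro mult_left_mono) auto
  finally show ?case using insert by simp
qed simp

text \<open>For finite \<open>A\<close>, expand the product of \<open>1 + (1 / f i - 1)\<close>,
  which is \<open>1 / prod f A\<close>; moreover \<open>1 - f i\<close> is at most
  \<open>1 / f i - 1\<close>, the gap being \<open>(1 - f i)\<^sup>2 / f i\<close>. The
  \<open>f i\<close> will be the distribution functions of the rewards at a point, so that
  \<open>prod f A\<close> is that of the prophet.\<close>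

lemma sum_one_minus_le_inverse_prod:
  fixes f :: "'b \<Rightarrow> real"
  assumes "\<And>i. i \<in> A \<Longrightarrow> 0 \<le> f i" "\<And>i. i \<in> A \<Longrightarrow> f i \<le> 1" and pos: "0 < prod f A"
  shows "(\<Sum>i\<in>A. 1 - f i) \<le> 1 / prod f A - 1"
proof (cases "finite A")
  case True
  have f: "0 < f i" "f i \<le> 1" if "i \<in> A" for i
    using assms(1,2)[OF that] pos True that
    by (auto simp: less_le prod_zero_iff)
  have "(\<Sum>i\<in>A. 1 - f i) \<le> (\<Sum>i\<in>A. 1 / f i - 1)"
  proof (rule sum_mono)
    fix i assume i: "i \<in> A"
    have "0 \<le> (1 - f i) * (1 - f i) / f i" using f[OF i] by simp
    also have "\<dots> = (1 / f i - 1) - (1 - f i)" using f[OF i] by (simp add: field_simps)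
    finally show "1 - f i \<le> 1 / f i - 1" by simp
  qed
  also have "\<dots> \<le> (\<Prod>i\<in>A. 1 + (1 / f i - 1)) - 1"
    using one_plus_sum_le_prod[of A "\<lambda>i. 1 / f i - 1"] f True by simp
  also have "(\<Prod>i\<in>A. 1 + (1 / f i - 1)) = 1 / prod f A"
    by (simp add: prod_dividef)
  finally show ?thesis .
\<comment> \<open>For infinite \<open>A\<close> the sum is 0 and the product is 1 by convention, so
  both sides are 0.\<close>
qed simp

section \<open>The distribution function of an atomless variable\<close>

text \<open>Collects what follows from the law of \<open>Z\<close> alone. Independence and the
  maximum enter only in the final theorem, where \<open>Z\<close> is the prophet.\<close>

locale atomless_nonneg_rv = prob_space M for M :: "'a measure" +
  fixes Z :: "'a \<Rightarrow> real"
  assumes rv [measurable]: "Z \<in> borel_measurable M"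
    and nonneg: "\<And>\<omega>. \<omega> \<in> space M \<Longrightarrow> 0 \<le> Z \<omega>"
    and atomless: "\<And>x. prob {\<omega>\<in>space M. Z \<omega> = x} = 0"
begin

definition dist_fun :: "real \<Rightarrow> real" where
  "dist_fun x = prob {\<omega>\<in>space M. Z \<omega> \<le> x}"

lemma dist_fun_eq_cdf: "dist_fun = cdf (distr M borel Z)"
  by (auto simp: dist_fun_def cdf_def measure_distr vimage_def Int_def conj_commute fun_eq_iff)

lemma dist_fun_mono: "x \<le> y \<Longrightarrow> dist_fun x \<le> dist_fun y"
  unfolding dist_fun_def by (intro finite_measure_mono) auto

lemma dist_fun_bounds: "0 \<le> dist_fun x" "dist_fun x \<le> 1"
  by (auto simp: dist_fun_def)

text \<open>The jump of a distribution function at \<open>x\<close> is the mass of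
  \<open>{x}\<close>. Continuity is what makes every level \<open>q < 1\<close> attained at its
  quantile.\<close>

lemma isCont_dist_fun: "isCont dist_fun x"
proof -
  interpret D: real_distribution "distr M borel Z" by simp
  have "measure (distr M borel Z) {x} = 0"
    using atomless[of x] by (simp add: measure_distr vimage_def Int_def conj_commute)
  then show ?thesis by (simp add: dist_fun_eq_cdf D.isCont_cdf)
qed

lemma dist_fun_measurable [measurable]: "dist_fun \<in> borel_measurable borel"
  by (intro borel_measurable_continuous_onI continuous_at_imp_continuous_on)
     (auto simp: isCont_dist_fun)

lemma dist_fun_0: "dist_fun 0 = 0"
proof -
  have "{\<omega>\<in>space M. Z \<omega> \<le> 0} = {\<omega>\<in>space M. Z \<omega> = 0}" using nonneg by force
  then show ?thesis by (simp add: dist_fun_def atomless)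
qed

lemma dist_fun_at_top: "(dist_fun \<longlongrightarrow> 1) at_top"
proof -
  interpret D: real_distribution "distr M borel Z" by simp
  show ?thesis by (simp add: dist_fun_eq_cdf D.cdf_lim_at_top_prob)
qed

section \<open>The quantile function\<close>

text \<open>Infinity is itself a competitor in the supremum, since the real-valued \<open>Z\<close>
  lies below it surely.\<close>

lemma quantile_one: "quantile M Z 1 = \<infinity>"
proof -
  have "\<infinity> \<in> {x. prob {\<omega>\<in>space M. ennreal (Z \<omega>) \<le> x} = 1}" by (simp add: prob_space)
  then have "\<infinity> \<le> quantile M Z 1" unfolding quantile_def by (rule Sup_upper)
  then show ?thesis by (simp add: top_unique)
qed

text \<open>The witness \<open>s\<close> is the largest point of \<open>S\<close>: the set is closed
  by continuity and bounded because \<open>dist_fun\<close> eventually exceeds \<open>q\<close>. The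
  final equivalence, valid for every real \<open>x\<close>, is what converts conditions on
  \<open>dist_fun\<close> into comparisons with the quantile.\<close>

lemma quantile_lt_one:
  assumes q: "0 \<le> q" "q < 1"
  obtains s where "s \<ge> 0" "quantile M Z q = ennreal s" "dist_fun s = q"
    "\<And>x. dist_fun x \<le> q \<longleftrightarrow> x \<le> s"
proof -
  define S where "S = {x. 0 \<le> x \<and> dist_fun x \<le> q}"
  define s where "s = Sup S"
  have 0: "0 \<in> S" using q by (simp add: S_def dist_fun_0)
  obtain b where b: "q < dist_fun b"
    using eventually_happens'[OF _ order_tendstoD(1)[OF dist_fun_at_top q(2)]] by auto
  have bdd: "bdd_above S"
  proof (rule bdd_aboveI)
    fix x assume "x \<in> S"
    then show "x \<le> b" using b dist_fun_mono[of b x] by (force simp: S_def)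
  qed
  have "closed S" unfolding S_def
    by (intro closed_Collect_conj closed_Collect_le continuous_intros
        continuous_at_imp_continuous_on ballI isCont_dist_fun)
  then have "s \<in> S" unfolding s_def using closed_contains_Sup[of S] 0 bdd by blast
  then have s: "0 \<le> s" "dist_fun s \<le> q" by (auto simp: S_def)
  have le_s: "x \<le> s" if "dist_fun x \<le> q" for x
  proof (cases "0 \<le> x")
    case True
    then show ?thesis unfolding s_def using that bdd by (intro cSup_upper) (auto simp: S_def)
  qed (use s in simp)
  \<comment> \<open>The intermediate value theorem yields a point \<open>y\<close> at or beyond
    \<open>s\<close> with value exactly \<open>q\<close>; maximality of \<open>s\<close> then forces
    \<open>y = s\<close>.\<close>
  have "s \<le> b" using s b dist_fun_mono[of b s] by linarith
  then obtain y where "s \<le> y" "y \<le> b" "dist_fun y = q"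
    using IVT[of dist_fun s q b] s b isCont_dist_fun by auto
  with le_s[of y] have eq: "dist_fun s = q" by simp
  have "quantile M Z q = ennreal s"
    unfolding quantile_def
  proof (rule antisym)
    show "Sup {x. prob {\<omega>\<in>space M. ennreal (Z \<omega>) \<le> x} = q} \<le> ennreal s"
    proof (rule Sup_least)
      fix x assume "x \<in> {x. prob {\<omega>\<in>space M. ennreal (Z \<omega>) \<le> x} = q}"
      then have x: "prob {\<omega>\<in>space M. ennreal (Z \<omega>) \<le> x} = q" by simp
      show "x \<le> ennreal s"
      proof (cases x)
        case (real r)
        then show ?thesis using x le_s[of r] by (simp add: dist_fun_def ennreal_leI)
      next
        \<comment> \<open>At infinity the probability is 1, which differs from \<open>q\<close>, so
          infinity does not compete here.\<close>
        case top
        then show ?thesis using x q by (simp add: prob_space)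
      qed
    qed
    show "ennreal s \<le> Sup {x. prob {\<omega>\<in>space M. ennreal (Z \<omega>) \<le> x} = q}"
      using s eq by (intro Sup_upper) (simp add: dist_fun_def)
  qed
  with s eq le_s that[of s] show ?thesis using dist_fun_mono[of _ s] by metis
qed

text \<open>The quantile becomes an integral over \<open>x\<close>, ready to be swapped with the
  integral over \<open>q\<close>.\<close>

lemma quantile_eq_nn_integral:
  assumes "0 \<le> q" "q < 1"
  shows "quantile M Z q = (\<integral>\<^sup>+x. indicator {x. 0 \<le> x \<and> dist_fun x \<le> q} x \<partial>lborel)"
proof -
  obtain s where s: "s \<ge> 0" "quantile M Z q = ennreal s" "dist_fun s = q"
      "\<And>x. dist_fun x \<le> q \<longleftrightarrow> x \<le> s"
    by (rule quantile_lt_one[OF assms]) (rule that)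
  have "{x. 0 \<le> x \<and> dist_fun x \<le> q} = {0..s}"
    unfolding s(4) by (simp add: set_eq_iff)
  then show ?thesis by (simp add: s(1,2))
qed

section \<open>The transform as an integral over values\<close>

text \<open>With the quantile written as a length, the left side is a double integral over
  \<open>q \<ge> p\<close> and \<open>q \<ge> dist_fun x\<close>. In the other order, the integral
  of \<open>1 / q\<^sup>2\<close> from \<open>max p (dist_fun x)\<close> to 1 is
  \<open>1 / max p (dist_fun x) - 1\<close>.\<close>

lemma nn_integral_quantile_over_square:
  assumes p: "0 < p" "p \<le> 1"
  shows "ennreal p * (\<integral>\<^sup>+q\<in>{p..1}. (quantile M Z q / ennreal (q\<^sup>2)) \<partial>lborel) =
    (\<integral>\<^sup>+x\<in>{0..}. ennreal (p / max p (dist_fun x) - p) \<partial>lborel)"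
proof -
  let ?g = "\<lambda>q x. indicator {0..} x *
    (ennreal (1 / q\<^sup>2) * indicator {max p (dist_fun x)..1} q) :: ennreal"
  have "(\<integral>\<^sup>+q\<in>{p..1}. (quantile M Z q / ennreal (q\<^sup>2)) \<partial>lborel) =
      (\<integral>\<^sup>+q. (\<integral>\<^sup>+x. ?g q x \<partial>lborel) \<partial>lborel)"
  \<comment> \<open>The null point \<open>q = 1\<close> is discarded because
    \<open>quantile_eq_nn_integral\<close> covers only \<open>q < 1\<close>.\<close>
  proof (rule nn_integral_cong_AE, rule AE_mp[OF AE_lborel_singleton[of 1]], intro AE_I2 impI)
    fix q :: real
    assume "q \<noteq> 1"
    show "quantile M Z q / ennreal (q\<^sup>2) * indicator {p..1} q = (\<integral>\<^sup>+x. ?g q x \<partial>lborel)"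
    proof (cases "q \<in> {p..1}")
      case True
      then have q: "0 < q" "q < 1" "p \<le> q" using p \<open>q \<noteq> 1\<close> by auto
      have "(\<integral>\<^sup>+x. ?g q x \<partial>lborel) =
          (\<integral>\<^sup>+x. ennreal (1 / q\<^sup>2) * indicator {x. 0 \<le> x \<and> dist_fun x \<le> q} x \<partial>lborel)"
        using q by (intro nn_integral_cong) (auto split: split_indicator)
      also have "\<dots> = ennreal (1 / q\<^sup>2) * quantile M Z q"
        using q by (subst nn_integral_cmult) (auto simp: quantile_eq_nn_integral)
      also have "\<dots> = quantile M Z q / ennreal (q\<^sup>2)"
        using q by (simp add: divide_ennreal_def inverse_ennreal mult.commute inverse_eq_divide)
      finally show ?thesis using True by simp
    next
      case False
      then have "?g q x = 0" for x by (auto split: split_indicator)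
      with False show ?thesis by simp
    qed
  qed
  also have "\<dots> = (\<integral>\<^sup>+x. (\<integral>\<^sup>+q. ?g q x \<partial>lborel) \<partial>lborel)"
  proof -
    \<comment> \<open>Written as inequalities between measurable functions of the pair, the
      integrand is visibly jointly measurable, as Fubini requires.\<close>
    have "(\<lambda>(q, x). ?g q x) =
        (\<lambda>(q, x). if 0 \<le> x \<and> max p (dist_fun x) \<le> q \<and> q \<le> 1 then ennreal (1 / q\<^sup>2) else 0)"
      by (auto simp: fun_eq_iff)
    moreover have "\<dots> \<in> borel_measurable (lborel \<Otimes>\<^sub>M lborel)" by measurable
    ultimately show ?thesis by (intro lborel_pair.Fubini'[symmetric]) simp
  qed
  also have "\<dots> = (\<integral>\<^sup>+x\<in>{0..}. ennreal (1 / max p (dist_fun x) - 1) \<partial>lborel)"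
  proof (rule nn_integral_cong)
    fix x
    define m where "m = max p (dist_fun x)"
    have m: "0 < m" "m \<le> 1" using p dist_fun_bounds[of x] by (auto simp: m_def)
    have "(\<integral>\<^sup>+q. ennreal (1 / q\<^sup>2) * indicator {m..1} q \<partial>lborel) =
        ennreal (- (1 / 1) - (- (1 / m)))"
    proof (rule nn_integral_FTC_Icc[where F = "\<lambda>q. - (1 / q)"])
      show "((\<lambda>q. - (1 / q)) has_field_derivative 1 / q\<^sup>2) (at q)"
        if "q \<in> {m..1}" for q
        using that m by (auto intro!: derivative_eq_intros simp: power2_eq_square)
    qed (use m in auto)
    then show "(\<integral>\<^sup>+q. ?g q x \<partial>lborel) =
        ennreal (1 / max p (dist_fun x) - 1) * indicator {0..} x"
      by (subst nn_integral_cmult) (auto simp: m_def mult.commute)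
  qed
  finally have "ennreal p * (\<integral>\<^sup>+q\<in>{p..1}. (quantile M Z q / ennreal (q\<^sup>2)) \<partial>lborel) =
      (\<integral>\<^sup>+x. ennreal p * (ennreal (1 / max p (dist_fun x) - 1) * indicator {0..} x) \<partial>lborel)"
    by (simp add: nn_integral_cmult)
  also have "\<dots> = (\<integral>\<^sup>+x\<in>{0..}. ennreal (p / max p (dist_fun x) - p) \<partial>lborel)"
  proof (rule nn_integral_cong)
    fix x
    have "p * (1 / max p (dist_fun x) - 1) = p / max p (dist_fun x) - p"
      by (simp add: right_diff_distrib)
    moreover have "0 \<le> 1 / max p (dist_fun x) - 1" using p dist_fun_bounds[of x] by simp
    ultimately show "ennreal p * (ennreal (1 / max p (dist_fun x) - 1) * indicator {0..} x) =
        ennreal (p / max p (dist_fun x) - p) * indicator {0..} x"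
      using p by (simp add: mult.assoc[symmetric] ennreal_mult'[symmetric])
  qed
  finally show ?thesis .
qed

lemma tail_transform_pos_eq:
  assumes p: "0 < p" "p \<le> 1"
  shows "tail_transform_pos M Z p =
    enn2real (\<integral>\<^sup>+x\<in>{0..}. ennreal (p / max p (dist_fun x) - p) \<partial>lborel)"
  using p unfolding nn_integral_quantile_over_square[OF p, symmetric] tail_transform_pos_def
  by (simp add: enn2real_mult)

text \<open>With \<open>m = max p (dist_fun x)\<close> the left side is
  \<open>(p / m) * (1 - m)\<close>, where \<open>p / m \<le> 1\<close>. The bound is independent of
  \<open>p\<close> and integrates over \<open>x \<ge> 0\<close> to the mean of \<open>Z\<close>, so
  it gives both finiteness and a majorant for the limit at 0.\<close>

lemma integrand_le:
  assumes p: "0 < p" "p \<le> 1"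
  shows "p / max p (dist_fun x) - p \<le> 1 - dist_fun x"
proof -
  define m where "m = max p (dist_fun x)"
  have m: "p \<le> m" "dist_fun x \<le> m" "m \<le> 1" using p dist_fun_bounds[of x] by (auto simp: m_def)
  have "p / m - p = (p / m) * (1 - m)" using p m by (simp add: field_simps)
  also have "\<dots> \<le> 1 * (1 - m)" using p m by (intro mult_right_mono) auto
  finally show ?thesis using m by (simp add: m_def)
qed

lemma nn_integral_eq_tail:
  "(\<integral>\<^sup>+\<omega>. ennreal (Z \<omega>) \<partial>M) = (\<integral>\<^sup>+x\<in>{0..}. ennreal (1 - dist_fun x) \<partial>lborel)"
  using expected_excess_eq_nn_integral_tail[OF rv, of 0]
  by (simp add: expected_excess_def dist_fun_def)

text \<open>Since \<open>enn2real\<close> sends infinity to 0, the integral can be recovered from it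
  only once it is known to be finite; the mean of \<open>Z\<close> bounds it.\<close>

lemma ennreal_tail_transform:
  assumes p: "0 < p" "p \<le> 1" and fin: "(\<integral>\<^sup>+\<omega>. ennreal (Z \<omega>) \<partial>M) < \<infinity>"
  shows "ennreal (tail_transform M Z p) =
    (\<integral>\<^sup>+x\<in>{0..}. ennreal (p / max p (dist_fun x) - p) \<partial>lborel)"
proof -
  have "(\<integral>\<^sup>+x\<in>{0..}. ennreal (p / max p (dist_fun x) - p) \<partial>lborel) \<le>
      (\<integral>\<^sup>+x\<in>{0..}. ennreal (1 - dist_fun x) \<partial>lborel)"
    using integrand_le[OF p] by (intro nn_integral_mono mult_right_mono ennreal_leI) auto
  also have "\<dots> < \<infinity>" using fin by (simp add: nn_integral_eq_tail)
  finally have "(\<integral>\<^sup>+x\<in>{0..}. ennreal (p / max p (dist_fun x) - p) \<partial>lborel) < \<infinity>" .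
  then show ?thesis using p by (simp add: tail_transform_def tail_transform_pos_eq)
qed

text \<open>As \<open>p\<close> decreases to 0, the integrand tends to 1 where
  \<open>dist_fun x = 0\<close> and to 0 where \<open>dist_fun x > 0\<close>. The limit is thus the
  length of the zero set of \<open>dist_fun\<close> on the half-line, which is the quantile at
  0.\<close>

lemma tail_transform_0:
  assumes fin: "(\<integral>\<^sup>+\<omega>. ennreal (Z \<omega>) \<partial>M) < \<infinity>"
  shows "ennreal (tail_transform M Z 0) = quantile M Z 0"
proof -
  have q0: "quantile M Z 0 < \<infinity>" using quantile_lt_one[of 0] by force
  have "(tail_transform_pos M Z \<longlongrightarrow> enn2real (quantile M Z 0)) (at_right 0)"
  \<comment> \<open>Dominated convergence concerns sequences, so the one-sided limit is tested along
    sequences in the open unit interval.\<close>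
  proof (rule tendsto_at_right_sequentially[of 0 1])
    fix S :: "nat \<Rightarrow> real"
    assume S: "\<And>n. 0 < S n" "\<And>n. S n < 1" "S \<longlonglongrightarrow> 0"
    have "(\<lambda>n. \<integral>\<^sup>+x\<in>{0..}. ennreal (S n / max (S n) (dist_fun x) - S n) \<partial>lborel) \<longlonglongrightarrow>
        (\<integral>\<^sup>+x. indicator {x. 0 \<le> x \<and> dist_fun x \<le> 0} x \<partial>lborel)"
    proof (rule nn_integral_dominated_convergence
        [where w = "\<lambda>x. ennreal (1 - dist_fun x) * indicator {0..} x"])
      show "AE x in lborel. ennreal (S j / max (S j) (dist_fun x) - S j) * indicator {0..} x \<le>
          ennreal (1 - dist_fun x) * indicator {0..} x" for j
        using integrand_le[of "S j"] S(1,2)[of j]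
        by (intro AE_I2 mult_right_mono ennreal_leI) auto
      show "(\<integral>\<^sup>+x\<in>{0..}. ennreal (1 - dist_fun x) \<partial>lborel) < \<infinity>"
        using fin by (simp add: nn_integral_eq_tail)
      show "AE x in lborel. (\<lambda>n. ennreal (S n / max (S n) (dist_fun x) - S n) * indicator {0..} x)
          \<longlonglongrightarrow> indicator {x. 0 \<le> x \<and> dist_fun x \<le> 0} x"
      proof (rule AE_I2)
        fix x :: real
        consider "x < 0" | "0 \<le> x" "dist_fun x = 0" | "0 \<le> x" "0 < dist_fun x"
          using dist_fun_bounds(1)[of x] by force
        then show "(\<lambda>n. ennreal (S n / max (S n) (dist_fun x) - S n) * indicator {0..} x)
            \<longlonglongrightarrow> indicator {x. 0 \<le> x \<and> dist_fun x \<le> 0} x"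
        proof cases
          case 1
          then show ?thesis by simp
        next
          case 2
          have "(\<lambda>n. ennreal (1 - S n)) \<longlonglongrightarrow> ennreal (1 - 0)"
            by (intro tendsto_ennrealI tendsto_intros S)
          moreover have "max (S n) 0 = S n" "S n \<noteq> 0" for n
            using S(1)[of n] by auto
          ultimately show ?thesis using 2 by simp
        next
          case 3
          have "(\<lambda>n. ennreal (S n / max (S n) (dist_fun x) - S n)) \<longlonglongrightarrow>
              ennreal (0 / max 0 (dist_fun x) - 0)"
            using 3 by (intro tendsto_ennrealI tendsto_intros S) auto
          then show ?thesis using 3 by simp
        qed
      qed
    qed measurable
    then have "(\<lambda>n. \<integral>\<^sup>+x\<in>{0..}. ennreal (S n / max (S n) (dist_fun x) - S n) \<partial>lborel)
        \<longlonglongrightarrow> quantile M Z 0"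
      by (simp add: quantile_eq_nn_integral)
    then have "(\<lambda>n. \<integral>\<^sup>+x\<in>{0..}. ennreal (S n / max (S n) (dist_fun x) - S n) \<partial>lborel)
        \<longlonglongrightarrow> ennreal (enn2real (quantile M Z 0))"
      using q0 by simp
    then have "(\<lambda>n. enn2real (\<integral>\<^sup>+x\<in>{0..}. ennreal (S n / max (S n) (dist_fun x) - S n) \<partial>lborel))
        \<longlonglongrightarrow> enn2real (quantile M Z 0)"
      by (intro tendsto_enn2real) auto
    then show "(\<lambda>n. tail_transform_pos M Z (S n)) \<longlonglongrightarrow> enn2real (quantile M Z 0)"
      using S(1,2) by (simp add: tail_transform_pos_eq less_imp_le)
  qed simp
  then have "tail_transform M Z 0 = enn2real (quantile M Z 0)"
    by (simp add: tail_transform_def tendsto_Lim)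
  with q0 show ?thesis by simp
qed

end

section \<open>The bound at the balanced threshold\<close>

theorem claim12:
  fixes M :: "'a measure" and n :: nat and v :: "nat \<Rightarrow> 'a \<Rightarrow> real" and p :: real
  assumes "prob_space M"
    and "n \<ge> 1"
    and "prob_space.indep_vars M (\<lambda>_. borel) v {1..n}"
    and "\<And>i \<omega>. i \<in> {1..n} \<Longrightarrow> \<omega> \<in> space M \<Longrightarrow> v i \<omega> \<ge> 0"
    and "\<And>i x. i \<in> {1..n} \<Longrightarrow> measure M {\<omega> \<in> space M. v i \<omega> = x} = 0"
    and "prob_space.expectation M (prophet n v) = 1"
    and "p \<in> {0..1}"
    and "quantile M (prophet n v) p =
           (\<Sum>i = 1..n. expected_excess M (v i) (quantile M (prophet n v) p))"
  shows "tail_transform M (prophet n v) p \<ge> 1 / 2"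
proof -
  interpret prob_space M by fact
  let ?Z = "prophet n v"
  have v_meas [measurable]: "v i \<in> borel_measurable M" if "i \<in> {1..n}" for i
    using assms(3) that by (auto simp: indep_vars_def)
  have Z_le: "?Z \<omega> \<le> x \<longleftrightarrow> (\<forall>i\<in>{1..n}. v i \<omega> \<le> x)" for \<omega> x
    unfolding prophet_def using assms(2) by (subst Max_le_iff) auto
  have Z_in: "\<exists>i\<in>{1..n}. ?Z \<omega> = v i \<omega>" for \<omega>
  proof -
    have "?Z \<omega> \<in> (\<lambda>i. v i \<omega>) ` {1..n}"
      unfolding prophet_def using assms(2) by (intro Max_in) auto
    then show ?thesis by blast
  qed
  have Z_meas: "?Z \<in> borel_measurable M"
    unfolding prophet_def[abs_def] using v_meas by (intro borel_measurable_Max) auto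
  interpret atomless_nonneg_rv M ?Z
  proof
    show "?Z \<in> borel_measurable M" by fact
    show "0 \<le> ?Z \<omega>" if "\<omega> \<in> space M" for \<omega>
      using Z_in[of \<omega>] assms(4)[OF _ that] by force
    show "prob {\<omega>\<in>space M. ?Z \<omega> = x} = 0" for x
    proof -
      have [measurable]: "{\<omega>\<in>space M. v i \<omega> = x} \<in> sets M" if "i \<in> {1..n}" for i
        using v_meas[OF that] by measurable
      have "prob {\<omega>\<in>space M. ?Z \<omega> = x} \<le> prob (\<Union>i\<in>{1..n}. {\<omega>\<in>space M. v i \<omega> = x})"
      proof (intro finite_measure_mono sets.finite_UN subsetI)
        fix \<omega> assume "\<omega> \<in> {\<omega>\<in>space M. ?Z \<omega> = x}"
        then show "\<omega> \<in> (\<Union>i\<in>{1..n}. {\<omega>\<in>space M. v i \<omega> = x})"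
          using Z_in[of \<omega>] by auto
      qed auto
      also have "\<dots> \<le> (\<Sum>i\<in>{1..n}. prob {\<omega>\<in>space M. v i \<omega> = x})"
        by (intro finite_measure_subadditive_finite) auto
      finally show ?thesis using assms(5) by (simp add: measure_le_0_iff)
    qed
  qed
  have EZ: "(\<integral>\<^sup>+\<omega>. ennreal (?Z \<omega>) \<partial>M) = 1"
  proof -
    \<comment> \<open>The Bochner integral of a non-integrable function is 0 by default, so
      expectation 1 forces integrability.\<close>
    have "integrable M ?Z" using assms(6) not_integrable_integral_eq by fastforce
    then show ?thesis using nonneg assms(6) by (subst nn_integral_eq_integral) auto
  qed
  then have fin: "(\<integral>\<^sup>+\<omega>. ennreal (?Z \<omega>) \<partial>M) < \<infinity>" by simp
  define G where "G i x = prob {\<omega>\<in>space M. v i \<omega> \<le> x}" for i x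
  have G_bounds: "0 \<le> G i x" "G i x \<le> 1" for i x by (auto simp: G_def)
  have G_meas: "G i \<in> borel_measurable borel" if "i \<in> {1..n}" for i
  proof (intro borel_measurable_mono monoI)
    fix x y :: real assume "x \<le> y"
    moreover have "{\<omega>\<in>space M. v i \<omega> \<le> y} \<in> sets M" using v_meas[OF that] by measurable
    ultimately show "G i x \<le> G i y" unfolding G_def by (intro finite_measure_mono) auto
  qed
  \<comment> \<open>The maximum is at most \<open>x\<close> iff every reward is, and independence
    factors this event.\<close>
  have F_prod: "dist_fun x = (\<Prod>i\<in>{1..n}. G i x)" for x
  proof -
    have "{\<omega>\<in>space M. ?Z \<omega> \<le> x} = (\<Inter>i\<in>{1..n}. v i -` {..x} \<inter> space M)"
      using assms(2) by (auto simp: Z_le)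
    then have "dist_fun x = prob (\<Inter>i\<in>{1..n}. v i -` {..x} \<inter> space M)"
      by (simp add: dist_fun_def)
    also have "\<dots> = (\<Prod>i\<in>{1..n}. prob (v i -` {..x} \<inter> space M))"
      using assms(2) by (intro indep_varsD[OF assms(3)]) auto
    also have "\<dots> = (\<Prod>i\<in>{1..n}. G i x)"
      by (intro prod.cong) (auto simp: G_def vimage_def Int_def conj_commute)
    finally show ?thesis .
  qed
  \<comment> \<open>At \<open>p = 1\<close> the quantile is infinite while every excess over
    infinity is 0, contradicting the balance equation.\<close>
  have "p \<noteq> 1"
  proof
    assume "p = 1"
    then show False using assms(8) by (simp add: quantile_one expected_excess_def)
  qed
  with assms(7) have p: "0 \<le> p" "p < 1" by auto
  obtain t where t: "t \<ge> 0" "quantile M ?Z p = ennreal t" "dist_fun t = p"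
    "\<And>x. dist_fun x \<le> p \<longleftrightarrow> x \<le> t" by (rule quantile_lt_one[OF p]) (rule that)
  have excess: "(\<Sum>i = 1..n. expected_excess M (v i) (ennreal t)) = ennreal t"
    using assms(8) t(2) by simp
  have "1 / 2 \<le> t"
  proof -
    \<comment> \<open>Pointwise, the maximal reward is at most \<open>t\<close> plus its own excess
      over \<open>t\<close>, which is one term of the sum of nonnegative excesses.\<close>
    have "1 \<le> (\<integral>\<^sup>+\<omega>. ennreal t + (\<Sum>i = 1..n. ennreal (v i \<omega>) - ennreal t) \<partial>M)"
      unfolding EZ[symmetric]
    proof (rule nn_integral_mono)
      fix \<omega>
      obtain i where i: "i \<in> {1..n}" "?Z \<omega> = v i \<omega>" using Z_in[of \<omega>] by blast
      have "ennreal (?Z \<omega>) \<le> ennreal t + (ennreal (v i \<omega>) - ennreal t)"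
        unfolding i(2) by (auto simp: add_diff_self_ennreal)
      also have "\<dots> \<le> ennreal t + (\<Sum>i = 1..n. ennreal (v i \<omega>) - ennreal t)"
        using i(1)
        by (intro add_left_mono member_le_sum[where f = "\<lambda>i. ennreal (v i \<omega>) - ennreal t"]) auto
      finally show "ennreal (?Z \<omega>) \<le> ennreal t + (\<Sum>i = 1..n. ennreal (v i \<omega>) - ennreal t)" .
    qed
    also have "\<dots> = ennreal t + (\<Sum>i = 1..n. expected_excess M (v i) (ennreal t))"
      unfolding expected_excess_def
      by (simp add: nn_integral_add nn_integral_sum emeasure_space_1 del: One_nat_def)
    also have "\<dots> = ennreal (2 * t)"
      unfolding excess using t(1) by (subst ennreal_plus[symmetric]) auto
    finally show ?thesis using t(1) ennreal_le_iff[of "2 * t" 1] by simp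
  qed
  moreover have "ennreal t \<le> ennreal (tail_transform M ?Z p)"
  proof (cases "p = 0")
    case True
    then show ?thesis using tail_transform_0[OF fin] t(2) by simp
  next
    case False
    with p have p: "0 < p" "p < 1" by auto
    have tail_meas: "(\<lambda>x. ennreal (1 - G i x) * indicator {t..} x) \<in> borel_measurable lborel"
      if "i \<in> {1..n}" for i
    proof -
      note [measurable] = G_meas[OF that]
      show ?thesis by measurable
    qed
    \<comment> \<open>Split \<open>t = (1 - p) * t + p * t\<close> and replace only the second
      \<open>t\<close> by the total excess. The two summands then become integrals over
      \<open>{0..<t}\<close> and \<open>{t..}\<close>, to be compared with the transform region by
      region.\<close>
    have "ennreal t = ennreal (1 - p) * ennreal t +
        ennreal p * (\<Sum>i = 1..n. expected_excess M (v i) (ennreal t))"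
    proof -
      have "ennreal t = ennreal ((1 - p) * t + p * t)" by (simp add: algebra_simps)
      also have "\<dots> = ennreal (1 - p) * ennreal t + ennreal p * ennreal t"
        using p t(1) by (subst ennreal_plus) (auto simp: ennreal_mult)
      finally show ?thesis unfolding excess .
    qed
    also have "\<dots> = (\<integral>\<^sup>+x. ennreal (1 - p) * indicator {0..<t} x \<partial>lborel) +
        ennreal p * (\<integral>\<^sup>+x. (\<Sum>i = 1..n. ennreal (1 - G i x) * indicator {t..} x) \<partial>lborel)"
    proof -
      have "(\<Sum>i = 1..n. expected_excess M (v i) (ennreal t)) =
          (\<Sum>i = 1..n. \<integral>\<^sup>+x\<in>{t..}. ennreal (1 - G i x) \<partial>lborel)"
        unfolding G_def
        by (intro sum.cong refl expected_excess_eq_nn_integral_tail v_meas t(1))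
      also have "\<dots> = (\<integral>\<^sup>+x. (\<Sum>i = 1..n. ennreal (1 - G i x) * indicator {t..} x) \<partial>lborel)"
        by (intro nn_integral_sum[symmetric] tail_meas)
      finally show ?thesis using t(1) by (simp add: nn_integral_cmult_indicator)
    qed
    also have "\<dots> = (\<integral>\<^sup>+x. ennreal (1 - p) * indicator {0..<t} x +
        ennreal p * (\<Sum>i = 1..n. ennreal (1 - G i x) * indicator {t..} x) \<partial>lborel)"
    proof -
      have "(\<lambda>x. \<Sum>i = 1..n. ennreal (1 - G i x) * indicator {t..} x) \<in> borel_measurable lborel"
        by (intro borel_measurable_sum tail_meas)
      then show ?thesis by (simp add: nn_integral_add nn_integral_cmult del: One_nat_def)
    qed
    also have "\<dots> \<le> (\<integral>\<^sup>+x\<in>{0..}. ennreal (p / max p (dist_fun x) - p) \<partial>lborel)"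
    proof (rule nn_integral_mono)
      fix x
      show "ennreal (1 - p) * indicator {0..<t} x +
          ennreal p * (\<Sum>i = 1..n. ennreal (1 - G i x) * indicator {t..} x)
        \<le> ennreal (p / max p (dist_fun x) - p) * indicator {0..} x"
      proof (cases "t \<le> x")
        case False
        \<comment> \<open>Below \<open>t\<close> the integrand of the transform is
          \<open>p / p - p = 1 - p\<close>, giving equality on \<open>{0..<t}\<close>; for negative
          \<open>x\<close> both sides vanish.\<close>
        then have "max p (dist_fun x) = p" using t(4)[of x] by auto
        with False p show ?thesis by (auto split: split_indicator)
      next
        case True
        then have F: "p \<le> dist_fun x" using t(3) dist_fun_mono by blast
        have "ennreal p * (\<Sum>i = 1..n. ennreal (1 - G i x)) = ennreal (p * (\<Sum>i = 1..n. 1 - G i x))"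
          using p G_bounds by (simp add: sum_ennreal ennreal_mult sum_nonneg)
        \<comment> \<open>The product inequality asks for a positive product, supplied by
          \<open>dist_fun x \<ge> p > 0\<close>; this is where the separation of the case
          \<open>p = 0\<close> matters.\<close>
        also have "\<dots> \<le> ennreal (p * (1 / dist_fun x - 1))"
          using p F G_bounds unfolding F_prod
          by (intro ennreal_leI mult_left_mono sum_one_minus_le_inverse_prod) auto
        also have "\<dots> = ennreal (p / max p (dist_fun x) - p)"
          using F by (simp add: right_diff_distrib max_absorb2)
        finally show ?thesis using True t(1) by simp
      qed
    qed
    also have "\<dots> = ennreal (tail_transform M ?Z p)"
      using p by (intro ennreal_tail_transform[symmetric] fin) auto
    finally show ?thesis .
  qed
  \<comment> \<open>A negative transform would be sent to 0 by \<open>ennreal\<close>, forcing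
    \<open>t \<le> 0\<close> against \<open>1 / 2 \<le> t\<close>.\<close>
  ultimately show ?thesis
    by (cases "0 \<le> tail_transform M ?Z p") (auto simp: ennreal_le_iff ennreal_neg)
qed

end
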